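(* Let $\mathcal C\subset\mathbb{R}^{nd}\times\mathbb{R}^n_{\ge0}$ be a closed, convex set with nonempty interior such that (i) the saddle points of $L_{\mathrm{aug}}$ over the domain $(\mathbb{R}^{nd}\times\mathbb{R}^n_{\ge0})\times(\mathbb{R}^n\times\mathbb{R}^{nd})$ are contained in the set $\mathcal C\times(\mathbb{R}^n\times\mathbb{R}^{nd})$; (ii) $\tilde L_{\mathrm{aug}}$ is convex-concave on $\mathcal C\times(\mathbb{R}^n\times\mathbb{R}^{nd}\times\mathbb{R}^{mN})$, i.e. convex in $(x_{\mathrm v},\lambda_{\mathrm v})\in\mathcal C$ and concave in $(\nu,\eta,\{\xi^k\})$; (iii) for any $(\nu,\eta)\in\mathbb{R}^n\times\mathbb{R}^{nd}$, $$\min_{(x_{\mathrm v},\lambda_{\mathrm v})\in\mathcal C}\;\max_{\{\xi^k\}}\tilde L_{\mathrm{aug}}(x_{\mathrm v},\lambda_{\mathrm v},\nu,\eta,\{\xi^k\})=\max_{\{\xi^k\}}\;\min_{(x_{\mathrm v},\lambda_{\mathrm v})\in\mathcal C}\tilde L_{\mathrm{aug}}(x_{\mathrm v},\lambda_{\mathrm v},\nu,\eta,\{\xi^k\}).$$ Then the following holds: (i) The set of saddle points of $\tilde L_{\mathrm{aug}}$ over the domain $\mathcal C\times(\mathbb{R}^n\times\mathbb{R}^{nd}\times\mathbb{R}^{mN})$ is nonempty, convex, and closed. (ii) If $(\bar x_{\mathrm v},\bar\lambda_{\mathrm v},\bar\nu,\bar\eta,\{\bar\xi^k\})$ is a saddle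 point of $\tilde L_{\mathrm{aug}}$ over $\mathcal C\times(\mathbb{R}^n\times\mathbb{R}^{nd}\times\mathbb{R}^{mN})$, then $(\bar x_{\mathrm v},\bar\lambda_{\mathrm v})$ is an optimizer of problem (D) stated in the context. (iii) If $(\bar x_{\mathrm v},\bar\lambda_{\mathrm v})\in\mathcal C$ is an optimizer of (D), then there exists $(\bar\nu,\bar\eta,\{\bar\xi^k\})$ such that $(\bar x_{\mathrm v},\bar\lambda_{\mathrm v},\bar\nu,\bar\eta,\{\bar\xi^k\})$ is a saddle point of $\tilde L_{\mathrm{aug}}$ over $\mathcal C\times(\mathbb{R}^n\times\mathbb{R}^{nd}\times\mathbb{R}^{mN})$.
   Context: $n,N,d,m$ are positive integers and $\epsilon\ge 0$. $\mathcal G$ is a connected undirected weighted graph on the vertex set $\{1,\dots,n\}$ (the agents) with symmetric adjacency matrix $\mathsf A=(a_{ij})$, $a_{ij}>0$ if $(i,j)$ is an edge and $a_{ij}=0$ otherwise; $\mathsf L=\mathsf D-\mathsf A$ is its Laplacian, where $\mathsf D$ is the diagonal matrix with entries $\sum_j a_{ij}$. The samples $\hat\xi^{\,1},\dots,\hat\xi^{\,N}\in\mathbb{R}^m$ are distributed among the agents: each sample is held by exactly one agent and each agent holds at least one; $v_k\in\{1,\dots,n\}$ is the agent holding $\hat\xi^{\,k}$. The function $f:\mathbb{R}^d\times\mathbb{R}^m\to\mathbb{R}$ is continuously differentiable; $x\mapsto f(x,\xi)$ is convex for every $\xi$; for every $x$, $\xi\mapsto f(x,\xi)$ is either convex or concave;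 and the set of $\xi\in\mathbb{R}^m$ for which neither $\mathbf 1_d$ nor $-\mathbf 1_d$ is a direction of recession of $x\mapsto f(x,\xi)$ is dense in $\mathbb{R}^m$ (a vector $w$ is a direction of recession of a finite convex function $\phi$ if $\phi(x+\alpha w)\le\phi(x)$ for all $x$ and $\alpha\ge0$). Notation: $h(\lambda_{\mathrm v}):=\epsilon^2(\mathbf 1_n^\top\lambda_{\mathrm v})/n$; $g_k(x,\lambda,\xi):=f(x,\xi)-\lambda\|\xi-\hat\xi^{\,k}\|^2$; $x_{\mathrm v}=(x^1;\dots;x^n)$ with $x^i\in\mathbb{R}^d$; $\lambda_{\mathrm v}=(\lambda^1;\dots;\lambda^n)$ with $\lambda^i\in\mathbb{R}$; $\nu\in\mathbb{R}^n$; $\eta\in\mathbb{R}^{nd}$; $\{\xi^k\}=(\xi^1,\dots,\xi^N)$ with $\xi^k\in\mathbb{R}^m$; $$F(x_{\mathrm v},\lambda_{\mathrm v}):=h(\lambda_{\mathrm v})+\frac1N\sum_{k=1}^N\max_{\xi\in\mathbb{R}^m}g_k(x^{v_k},\lambda^{v_k},\xi)\in(-\infty,+\infty],$$ $$L_{\mathrm{aug}}(x_{\mathrm v},\lambda_{\mathrm v},\nu,\eta):=F(x_{\mathrm v},\lambda_{\mathrm v})+\nu^\top\mathsf L\lambda_{\mathrm v}+\eta^\top(\mathsf L\otimes\mathsf I_d)x_{\mathrm v}+\tfrac12x_{\mathrm v}^\top(\mathsf L\otimes\mathsf I_d)x_{\mathrm v}+\tfrac12\lambda_{\mathrm v}^\top\mathsf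 L\lambda_{\mathrm v},$$ $$\tilde L_{\mathrm{aug}}(x_{\mathrm v},\lambda_{\mathrm v},\nu,\eta,\{\xi^k\}):=h(\lambda_{\mathrm v})+\frac1N\sum_{k=1}^Ng_k(x^{v_k},\lambda^{v_k},\xi^k)+\nu^\top\mathsf L\lambda_{\mathrm v}+\eta^\top(\mathsf L\otimes\mathsf I_d)x_{\mathrm v}+\tfrac12x_{\mathrm v}^\top(\mathsf L\otimes\mathsf I_d)x_{\mathrm v}+\tfrac12\lambda_{\mathrm v}^\top\mathsf L\lambda_{\mathrm v}.$$ $\mathbf 1_n,\mathbf 0_n$ are the all-ones and zero vectors, $\mathsf I_d$ the identity, $\otimes$ the Kronecker product; vector inequalities are componentwise. The symbols $\min$ and $\max$ are read as infimum and supremum in the extended reals. Problem (D): minimize $F(x_{\mathrm v},\lambda_{\mathrm v})$ over $x_{\mathrm v}\in\mathbb{R}^{nd}$, $\lambda_{\mathrm v}\ge\mathbf 0_n$ subject to $\mathsf L\lambda_{\mathrm v}=\mathbf 0_n$ and $(\mathsf L\otimes\mathsf I_d)x_{\mathrm v}=\mathbf 0_{nd}$. Standing assumption: for problem (P), $\inf_{\lambda\ge0,\,x\in\mathbb{R}^d}\{\lambda\epsilon^2+\frac1N\sum_{k=1}^N\max_{\xi\in\mathbb{R}^m}g_k(x,\lambda,\xi)\}$, the set of $(\lambda,x)\in\mathbb{R}_{\ge0}\times\mathbb{R}^d$ at which the objective is finite has nonempty interior, and there exists a finite optimizer $(x^*,\lambda^* )$. A point $(p_*,q_* )\in\mathcal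 P\times\mathcal Q$ is a saddle point of $\Phi$ over $\mathcal P\times\mathcal Q$ if $\Phi(p_*,q)\le\Phi(p_*,q_* )\le\Phi(p,q_* )$ for all $p\in\mathcal P$, $q\in\mathcal Q$. *)

theory Defs
  imports "HOL-Analysis.Analysis"
begin

text \<open>
  Dimensions are types: agents \<open>'n\<close>, samples \<open>'N\<close>, decision space \<open>real^'d\<close>, uncertainty space
  \<open>real^'m\<close>. The vector (x^1; ...; x^n) of dimension nd is an element of \<open>real^('n \<times> 'd)\<close>, so
  that the Kronecker product with the identity acts on it as an ordinary matrix.
\<close>

subsection \<open>Graphs and matrices\<close>

definition weighted_graph :: "('n \<times> 'n) set \<Rightarrow> real^'n^'n \<Rightarrow> bool" where
  "weighted_graph E A \<longleftrightarrow>
     sym E \<and> transpose A = A \<and> (\<forall>i j. if (i, j) \<in> E then A $ i $ j > 0 else A $ i $ j = 0)"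

definition connected_graph :: "('n \<times> 'n) set \<Rightarrow> bool" where
  "connected_graph E \<longleftrightarrow> (\<forall>i j. (i, j) \<in> E\<^sup>*)"

definition laplacian :: "real^'n^'n \<Rightarrow> real^'n^'n" where
  "laplacian A = (\<chi> i j. if i = j then \<Sum>k\<in>UNIV. A $ i $ k else 0) - A"

definition kron :: "real^'b::finite^'a::finite \<Rightarrow> real^'d::finite^'c::finite \<Rightarrow> real^('b \<times> 'd)^('a \<times> 'c)" where
  "kron A B = (\<chi> p q. A $ fst p $ fst q * B $ snd p $ snd q)"

definition block :: "real^('n::finite \<times> 'd::finite) \<Rightarrow> 'n \<Rightarrow> real^'d" where
  "block x i = (\<chi> j. x $ (i, j))"


subsection \<open>Analytic notions\<close>

definition continuously_differentiable ::
  "('a::real_normed_vector \<Rightarrow> 'b::real_normed_vector) \<Rightarrow> bool" where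
  "continuously_differentiable f \<longleftrightarrow>
     (\<exists>f' :: 'a \<Rightarrow> 'a \<Rightarrow>\<^sub>L 'b. (\<forall>z. (f has_derivative blinfun_apply (f' z)) (at z))
        \<and> continuous_on UNIV f')"

definition recession_direction :: "('a::real_vector \<Rightarrow> real) \<Rightarrow> 'a \<Rightarrow> bool" where
  "recession_direction \<phi> w \<longleftrightarrow> (\<forall>x. \<forall>\<alpha>\<ge>0. \<phi> (x + \<alpha> *\<^sub>R w) \<le> \<phi> x)"

definition saddle_points ::
  "('p \<Rightarrow> 'q \<Rightarrow> 'a::linorder) \<Rightarrow> 'p set \<Rightarrow> 'q set \<Rightarrow> ('p \<times> 'q) set" where
  "saddle_points \<Phi> P Q = {(p0, q0). p0 \<in> P \<and> q0 \<in> Q \<and>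
     (\<forall>p\<in>P. \<forall>q\<in>Q. \<Phi> p0 q \<le> \<Phi> p0 q0 \<and> \<Phi> p0 q0 \<le> \<Phi> p q0)}"


subsection \<open>Objective and augmented Lagrangians\<close>

text \<open>The order on \<open>real^'n\<close> is componentwise and \<open>1\<close> is the all-ones vector.\<close>

definition h :: "real \<Rightarrow> real^'n \<Rightarrow> real" where
  "h \<epsilon> l = \<epsilon>\<^sup>2 * (1 \<bullet> l) / real CARD('n)"

definition g :: "((real^'d) \<times> (real^'m) \<Rightarrow> real) \<Rightarrow> real^'m^'N \<Rightarrow> 'N \<Rightarrow> real^'d \<Rightarrow> real \<Rightarrow> real^'m \<Rightarrow> real" where
  "g f \<xi>hat k x l \<xi> = f (x, \<xi>) - l * (norm (\<xi> - \<xi>hat $ k))\<^sup>2"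

definition P_objective ::
  "real \<Rightarrow> ((real^'d) \<times> (real^'m) \<Rightarrow> real) \<Rightarrow> real^'m^'N \<Rightarrow> real \<times> (real^'d) \<Rightarrow> ereal" where
  "P_objective \<epsilon> f \<xi>hat = (\<lambda>(l, x).
     ereal (l * \<epsilon>\<^sup>2) + ereal (1 / real CARD('N)) * (\<Sum>k\<in>UNIV. SUP \<xi>. ereal (g f \<xi>hat k x l \<xi>)))"

text \<open>Each supremum below is greater than \<open>-\<infinity>\<close>, so the extended-real sums never involve
  \<open>\<infinity> + (-\<infinity>)\<close>.\<close>

definition D_objective ::
  "real \<Rightarrow> ((real^'d) \<times> (real^'m) \<Rightarrow> real) \<Rightarrow> real^'m^'N \<Rightarrow> ('N \<Rightarrow> 'n) \<Rightarrow>
   (real^('n::finite \<times> 'd::finite)) \<times> (real^'n) \<Rightarrow> ereal" where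
  "D_objective \<epsilon> f \<xi>hat v = (\<lambda>(x, l).
     ereal (h \<epsilon> l) +
     ereal (1 / real CARD('N)) *
       (\<Sum>k\<in>UNIV. SUP \<xi>. ereal (g f \<xi>hat k (block x (v k)) (l $ v k) \<xi>)))"

definition D_feasible :: "real^'n^'n \<Rightarrow> ((real^('n::finite \<times> 'd::finite)) \<times> (real^'n)) set" where
  "D_feasible L = {(x, l). 0 \<le> l \<and> L *v l = 0 \<and> kron L (mat 1 :: real^'d^'d) *v x = 0}"

definition D_optimizer ::
  "real \<Rightarrow> ((real^'d) \<times> (real^'m) \<Rightarrow> real) \<Rightarrow> real^'m^'N \<Rightarrow> ('N \<Rightarrow> 'n) \<Rightarrow> real^'n^'n \<Rightarrow>
   (real^('n::finite \<times> 'd::finite)) \<times> (real^'n) \<Rightarrow> bool" where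
  "D_optimizer \<epsilon> f \<xi>hat v L = is_arg_min (D_objective \<epsilon> f \<xi>hat v) (\<lambda>p. p \<in> D_feasible L)"

definition coupling ::
  "real^'n^'n \<Rightarrow> real^('n::finite \<times> 'd::finite) \<Rightarrow> real^'n \<Rightarrow> real^'n \<Rightarrow> real^('n::finite \<times> 'd::finite) \<Rightarrow> real" where
  "coupling L x l \<nu> \<eta> =
     \<nu> \<bullet> (L *v l) + \<eta> \<bullet> (kron L (mat 1 :: real^'d^'d) *v x)
     + 1/2 * (x \<bullet> (kron L (mat 1 :: real^'d^'d) *v x)) + 1/2 * (l \<bullet> (L *v l))"

definition L_aug ::
  "real \<Rightarrow> ((real^'d) \<times> (real^'m) \<Rightarrow> real) \<Rightarrow> real^'m^'N \<Rightarrow> ('N \<Rightarrow> 'n) \<Rightarrow> real^'n^'n \<Rightarrow>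
   (real^('n::finite \<times> 'd::finite)) \<times> (real^'n) \<Rightarrow> (real^'n) \<times> (real^('n::finite \<times> 'd::finite)) \<Rightarrow> ereal" where
  "L_aug \<epsilon> f \<xi>hat v L = (\<lambda>(x, l) (\<nu>, \<eta>).
     D_objective \<epsilon> f \<xi>hat v (x, l) + ereal (coupling L x l \<nu> \<eta>))"

definition Ltilde_aug ::
  "real \<Rightarrow> ((real^'d) \<times> (real^'m) \<Rightarrow> real) \<Rightarrow> real^'m^'N \<Rightarrow> ('N \<Rightarrow> 'n) \<Rightarrow> real^'n^'n \<Rightarrow>
   (real^('n::finite \<times> 'd::finite)) \<times> (real^'n) \<Rightarrow> (real^'n) \<times> (real^('n::finite \<times> 'd::finite)) \<times> (real^'m^'N) \<Rightarrow> real" where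
  "Ltilde_aug \<epsilon> f \<xi>hat v L = (\<lambda>(x, l) (\<nu>, \<eta>, \<xi>).
     h \<epsilon> l + 1 / real CARD('N) * (\<Sum>k\<in>UNIV. g f \<xi>hat k (block x (v k)) (l $ v k) (\<xi> $ k))
     + coupling L x l \<nu> \<eta>)"

end

theory Submission
  imports Defs
begin

text \<open>
  The objective of (D) is convex, and the interior point of the domain of (P) gives by consensus a
  feasible point in the interior of its domain. Separating \<open>{(B p, t). F p - F p\<^sub>* < t}\<close> from the
  origin, where \<open>B\<close> collects the two Laplacian constraints, yields multipliers at every optimizer
  \<open>p\<^sub>*\<close> of (D); as the quadratic terms are nonnegative, these multipliers complete \<open>p\<^sub>*\<close> to a saddle
  point of \<open>L_aug\<close>, so \<open>p\<^sub>*\<close> lies in \<open>C\<close>.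
  For these multipliers the minimax equality makes the optimal value the supremum over \<open>\<xi>\<close> of the
  minimum over \<open>C\<close>. It is attained: at an interior point of \<open>C\<close> one can lower \<open>\<lambda>\<close> without leaving \<open>C\<close>,
  so \<open>Ltilde_aug\<close> is strongly concave in \<open>\<xi>\<close> there and the superlevel sets of the minimum are compact.
  A maximizing \<open>\<xi>\<close> completes \<open>p\<^sub>*\<close> to a saddle point of \<open>Ltilde_aug\<close>.
  Conversely, boundedness of \<open>Ltilde_aug\<close> in the multipliers forces feasibility, and comparison with
  an optimizer of (D), which lies in \<open>C\<close>, shows optimality.
\<close>

subsection \<open>Saddle points and Lagrange multipliers\<close>

text \<open>Setting \<open>p = p0\<close> or \<open>q = q0\<close> in the single inequality recovers
  the two halves of the definition. It puts \<open>p0\<close> and \<open>q0\<close> on opposite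
  sides, which the next two lemmas exploit.\<close>

lemma saddle_points_iff:
  "(p0, q0) \<in> saddle_points \<Phi> P Q \<longleftrightarrow>
     p0 \<in> P \<and> q0 \<in> Q \<and> (\<forall>p\<in>P. \<forall>q\<in>Q. \<Phi> p0 q \<le> \<Phi> p q0)"
  unfolding saddle_points_def by (auto intro: order_trans)

text \<open>For fixed \<open>p\<close> and \<open>q\<close>, one side of the inequality depends on
  \<open>p0\<close> alone and the other on \<open>q0\<close> alone, so separate continuity is
  enough.\<close>

lemma closed_saddle_points:
  fixes \<Phi> :: "'p::topological_space \<Rightarrow> 'q::topological_space \<Rightarrow> real"
  assumes "closed P" "closed Q"
    and "\<And>p. continuous_on UNIV (\<Phi> p)" "\<And>q. continuous_on UNIV (\<lambda>p. \<Phi> p q)"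
  shows "closed (saddle_points \<Phi> P Q)"
proof -
  have "saddle_points \<Phi> P Q = (P \<times> Q) \<inter> (\<Inter>p\<in>P. \<Inter>q\<in>Q. {z. \<Phi> (fst z) q \<le> \<Phi> p (snd z)})"
    by (auto simp: saddle_points_iff)
  moreover have "closed {z. \<Phi> (fst z) q \<le> \<Phi> p (snd z)}" for p q
    by (intro closed_Collect_le continuous_on_compose2[OF assms(3)]
        continuous_on_compose2[OF assms(4)] continuous_on_fst continuous_on_snd continuous_on_id) auto
  ultimately show ?thesis
    using assms(1,2) by (auto intro!: closed_Int closed_INT closed_Times)
qed

lemma convex_saddle_points:
  assumes "convex P" "convex Q"
    and "\<And>q. convex_on P (\<lambda>p. \<Phi> p q)" "\<And>p. p \<in> P \<Longrightarrow> concave_on Q (\<Phi> p)"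
  shows "convex (saddle_points \<Phi> P Q)"
proof (rule convexI)
  fix z w :: "'a \<times> 'b" and s t :: real
  assume z: "z \<in> saddle_points \<Phi> P Q" and w: "w \<in> saddle_points \<Phi> P Q"
    and st: "0 \<le> s" "0 \<le> t" "s + t = 1"
  obtain p1 q1 p2 q2 where eq: "z = (p1, q1)" "w = (p2, q2)"
    by (metis surj_pair)
  have mem: "p1 \<in> P" "q1 \<in> Q" "p2 \<in> P" "q2 \<in> Q"
    using z w by (auto simp: eq saddle_points_iff)
  have "\<Phi> (s *\<^sub>R p1 + t *\<^sub>R p2) q \<le> \<Phi> p (s *\<^sub>R q1 + t *\<^sub>R q2)" if "p \<in> P" "q \<in> Q" for p q
  proof -
    have "\<Phi> (s *\<^sub>R p1 + t *\<^sub>R p2) q \<le> s * \<Phi> p1 q + t * \<Phi> p2 q"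
      using assms(3)[of q] mem st unfolding convex_on_def by blast
    also have "\<dots> \<le> s * \<Phi> p q1 + t * \<Phi> p q2"
      using z w st that by (intro add_mono mult_left_mono) (auto simp: eq saddle_points_iff)
    also have "\<dots> \<le> \<Phi> p (s *\<^sub>R q1 + t *\<^sub>R q2)"
      using assms(4)[OF \<open>p \<in> P\<close>] mem st unfolding concave_on_iff by blast
    finally show ?thesis .
  qed
  then show "s *\<^sub>R z + t *\<^sub>R w \<in> saddle_points \<Phi> P Q"
    using mem st assms(1,2) by (auto simp: eq saddle_points_iff intro: convexD)
qed

text \<open>Slater's condition: the interior feasible point \<open>p0\<close> keeps the separating
  hyperplane from being vertical, so its normal \<open>(y, s)\<close> can be divided by
  \<open>s\<close>.\<close>

lemma lagrange_multiplier_exists: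
  fixes F :: "'a::euclidean_space \<Rightarrow> real" and B :: "'a \<Rightarrow> 'b::euclidean_space"
  assumes B: "linear B" and F: "convex_on D F"
    and p0: "p0 \<in> interior D" "B p0 = 0"
    and m: "\<And>p. p \<in> D \<Longrightarrow> B p = 0 \<Longrightarrow> m \<le> F p"
  obtains y where "\<And>p. p \<in> D \<Longrightarrow> m \<le> F p + y \<bullet> B p"
proof -
  interpret B: linear B by fact
  define S where "S = {(B p, t) | p t. p \<in> D \<and> F p - m < t}"
  have p0D: "p0 \<in> D" using p0(1) interior_subset by blast
  have "convex S"
  proof (rule convexI)
    fix a b and s t :: real
    assume "a \<in> S" "b \<in> S" and st: "0 \<le> s" "0 \<le> t" "s + t = 1"
    then obtain p r p' r' where eq: "a = (B p, r)" "b = (B p', r')"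
      and p: "p \<in> D" "F p - m < r" "p' \<in> D" "F p' - m < r'"
      unfolding S_def by blast
    have "F (s *\<^sub>R p + t *\<^sub>R p') \<le> s * F p + t * F p'"
      using F p st unfolding convex_on_def by blast
    also have "\<dots> - m = s * (F p - m) + t * (F p' - m)"
      using st(3) by (simp add: algebra_simps) (metis distrib_left mult.right_neutral)
    also have "\<dots> < s * r + t * r'"
    \<comment> \<open>Strictness survives only a positive weight; if \<open>s\<close> vanishes, then
      \<open>t = 1\<close> carries it.\<close>
    proof (cases "s = 0")
      case False
      then have "s * (F p - m) < s * r" using p st by simp
      moreover have "t * (F p' - m) \<le> t * r'" using p st by (intro mult_left_mono) auto
      ultimately show ?thesis by simp
    qed (use p st in auto)
    finally have "F (s *\<^sub>R p + t *\<^sub>R p') - m < s * r + t * r'" by simp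
    moreover have "s *\<^sub>R p + t *\<^sub>R p' \<in> D"
      using convex_on_imp_convex[OF F] p st by (simp add: convexD)
    ultimately show "s *\<^sub>R a + t *\<^sub>R b \<in> S"
      unfolding S_def eq by (auto simp: B.add B.scale intro!: exI[of _ "s *\<^sub>R p + t *\<^sub>R p'"])
  qed
  moreover have "(B p0, F p0 - m + 1) \<in> S"
    using p0D unfolding S_def by auto
  then have "S \<noteq> {}" by blast
  moreover have "0 \<notin> S"
    using m unfolding S_def zero_prod_def by force
  \<comment> \<open>The normal is taken inside \<open>span S\<close> because \<open>B\<close> may
    fail to be onto; otherwise a normal orthogonal to the range of \<open>B\<close> would separate
    without giving information.\<close>
  ultimately obtain a where a: "a \<in> span S" "a \<noteq> 0" "\<And>z. z \<in> S \<Longrightarrow> 0 \<le> a \<bullet> z"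
    using separating_hyperplane_set_0_inspan[of S] by metis
  obtain y s where as: "a = (y, s)" by (cases a)
  have sep: "0 \<le> y \<bullet> B p + s * t" if "p \<in> D" "F p - m < t" for p t
    using a(3)[of "(B p, t)"] that unfolding S_def as by auto
  have "s \<ge> 0"
  proof (rule ccontr)
    assume "\<not> s \<ge> 0"
    \<comment> \<open>This \<open>t\<close> is positive and exceeds \<open>F p0 - m\<close>, so its
      product with \<open>s\<close> shows the sign of \<open>s\<close>.\<close>
    define t where "t = F p0 - m + 1 + \<bar>F p0 - m\<bar>"
    have "0 \<le> s * t" "t > 0"
      using sep[OF p0D, of t] p0(2) unfolding t_def by auto
    with \<open>\<not> s \<ge> 0\<close> show False
      by (simp add: zero_le_mult_iff)
  qed
  moreover have "s \<noteq> 0"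
  proof
    assume s: "s = 0"
    \<comment> \<open>With \<open>s = 0\<close> the normal is \<open>(B d, 0)\<close>. A small step
      from \<open>p0\<close> along \<open>-d\<close> stays in \<open>D\<close> and makes the inner
      product with \<open>y\<close> negative unless \<open>y = 0\<close>.\<close>
    have "span S \<subseteq> range B \<times> UNIV"
      by (rule span_minimal) (auto simp: S_def intro!: subspace_Times linear_subspace_image B)
    then obtain d where d: "y = B d"
      using a(1) as by auto
    have nonneg: "0 \<le> y \<bullet> B p" if "p \<in> D" for p
      using sep[OF that, of "F p - m + 1"] s by simp
    obtain e where e: "e > 0" "cball p0 e \<subseteq> D"
      using p0(1) by (auto simp: mem_interior_cball)
    \<comment> \<open>The added 1 avoids division by zero when \<open>d = 0\<close>.\<close>
    define c where "c = e / (norm d + 1)"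
    have c: "c > 0" "c * norm d \<le> e"
      using e(1) norm_ge_zero[of d] unfolding c_def by (auto simp: field_simps add_pos_nonneg intro!: mult_left_mono)
    then have "p0 - c *\<^sub>R d \<in> D"
      using e(2) by (auto simp: dist_norm)
    then have "0 \<le> - (c * (y \<bullet> y))"
      using nonneg[of "p0 - c *\<^sub>R d"] p0(2) by (simp add: B.diff B.scale d)
    then have "y \<bullet> y \<le> 0"
      using c(1) by (simp add: mult_le_0_iff)
    then have "y = 0"
      by (metis inner_gt_zero_iff not_le)
    then show False
      using a(2) s as by (simp add: zero_prod_def)
  qed
  ultimately have s: "s > 0" by simp
  have "m \<le> F p + (y /\<^sub>R s) \<bullet> B p" if "p \<in> D" for p
  proof (rule field_le_epsilon)
    fix e :: real assume "e > 0"
    then have "0 \<le> y \<bullet> B p + s * (F p - m + e)"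
      using sep[OF that] by simp
    then have "0 \<le> (y \<bullet> B p + s * (F p - m + e)) / s"
      using s by simp
    also have "\<dots> = (y /\<^sub>R s) \<bullet> B p + (F p - m + e)"
      using s by (simp add: field_simps)
    finally show "m \<le> F p + (y /\<^sub>R s) \<bullet> B p + e" by simp
  qed
  then show thesis by (rule that)
qed


subsection \<open>Laplacian and consensus\<close>

lemma laplacian_mult_nth:
  "(laplacian A *v l) $ i = (\<Sum>j\<in>UNIV. A $ i $ j * (l $ i - l $ j))"
proof -
  have "(laplacian A *v l) $ i =
      (\<Sum>j\<in>UNIV. (if i = j then (\<Sum>k\<in>UNIV. A $ i $ k) * l $ j else 0) - A $ i $ j * l $ j)"
    unfolding laplacian_def matrix_vector_mult_def
    by (auto simp: algebra_simps intro!: sum.cong)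
  also have "\<dots> = (\<Sum>k\<in>UNIV. A $ i $ k) * l $ i - (\<Sum>j\<in>UNIV. A $ i $ j * l $ j)"
    by (simp add: sum_subtractf)
  finally show ?thesis
    by (simp add: right_diff_distrib sum_subtractf sum_distrib_right)
qed

text \<open>By symmetry of \<open>A\<close>, averaging the double sum with its copy under exchange
  of \<open>i\<close> and \<open>j\<close> completes the square.\<close>

lemma laplacian_quadratic:
  assumes "transpose A = A"
  shows "l \<bullet> (laplacian A *v l) = 1/2 * (\<Sum>i\<in>UNIV. \<Sum>j\<in>UNIV. A $ i $ j * (l $ i - l $ j)\<^sup>2)"
proof -
  have sym: "A $ i $ j = A $ j $ i" for i j
    by (metis assms transpose_def vec_lambda_beta)
  let ?T = "\<lambda>i j. A $ i $ j * (l $ i - l $ j) * l $ i"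
  have lhs: "l \<bullet> (laplacian A *v l) = (\<Sum>i\<in>UNIV. \<Sum>j\<in>UNIV. ?T i j)"
    by (simp add: inner_vec_def laplacian_mult_nth sum_distrib_left algebra_simps)
  also have "\<dots> = (\<Sum>i\<in>UNIV. \<Sum>j\<in>UNIV. ?T j i)"
    by (rule sum.swap)
  finally have "2 * (l \<bullet> (laplacian A *v l)) = (\<Sum>i\<in>UNIV. \<Sum>j\<in>UNIV. ?T i j + ?T j i)"
    using lhs by (simp add: sum.distrib)
  also have "\<dots> = (\<Sum>i\<in>UNIV. \<Sum>j\<in>UNIV. A $ i $ j * (l $ i - l $ j)\<^sup>2)"
    by (intro sum.cong refl) (subst (2) sym, simp add: power2_eq_square algebra_simps)
  finally show ?thesis by simp
qed

lemma weighted_graph_nonneg: "weighted_graph E A \<Longrightarrow> 0 \<le> A $ i $ j"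
  unfolding weighted_graph_def by (metis less_eq_real_def)

lemma laplacian_psd:
  assumes "weighted_graph E A"
  shows "0 \<le> l \<bullet> (laplacian A *v l)"
proof -
  have "transpose A = A" using assms by (simp add: weighted_graph_def)
  then show ?thesis
    using weighted_graph_nonneg[OF assms] by (simp add: laplacian_quadratic sum_nonneg)
qed

text \<open>On the kernel the quadratic form vanishes, hence so does each of its nonnegative terms.
  This gives equality across every edge, and connectedness carries it along paths.\<close>

lemma laplacian_kernel:
  assumes G: "weighted_graph E A" "connected_graph E"
  shows "laplacian A *v l = 0 \<longleftrightarrow> (\<forall>i j. l $ i = l $ j)"
proof
  assume "laplacian A *v l = 0"
  moreover have "transpose A = A" using G by (simp add: weighted_graph_def)
  ultimately have "(\<Sum>i\<in>UNIV. \<Sum>j\<in>UNIV. A $ i $ j * (l $ i - l $ j)\<^sup>2) = 0"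
    using laplacian_quadratic[of A l] by simp
  then have z: "A $ i $ j * (l $ i - l $ j)\<^sup>2 = 0" for i j
    using weighted_graph_nonneg[OF G(1)] by (simp add: sum_nonneg_eq_0_iff sum_nonneg)
  have edge: "l $ i = l $ j" if "(i, j) \<in> E" for i j
  proof -
    have "A $ i $ j > 0" using G(1) that unfolding weighted_graph_def by metis
    with z[of i j] show ?thesis by simp
  qed
  have "l $ i = l $ j" if "(i, j) \<in> E\<^sup>*" for i j
    using that by induction (auto dest: edge)
  then show "\<forall>i j. l $ i = l $ j"
    using G(2) by (auto simp: connected_graph_def)
next
  assume c: "\<forall>i j. l $ i = l $ j"
  have "A $ i $ j * (l $ i - l $ j) = 0" for i j
    using c[rule_format, of i j] by simp
  then show "laplacian A *v l = 0"
    by (simp add: vec_eq_iff laplacian_mult_nth sum.neutral del: mult_eq_0_iff)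
qed

text \<open>The Kronecker matrix applies \<open>L\<close> separately to each of the decision
  coordinates, so positivity and the kernel carry over from the Laplacian.\<close>

lemma kron_mat_1_mult_nth:
  "(kron L (mat 1 :: real^'d^'d) *v x) $ (i, j) = (L *v (\<chi> i. x $ (i, j))) $ i"
proof -
  have "(kron L (mat 1 :: real^'d^'d) *v x) $ (i, j) =
      (\<Sum>i'\<in>UNIV. \<Sum>j'\<in>UNIV. L $ i $ i' * (if j = j' then 1 else 0) * x $ (i', j'))"
    by (simp add: matrix_vector_mult_def kron_def mat_def sum.cartesian_product UNIV_Times_UNIV[symmetric] case_prod_beta
        del: UNIV_Times_UNIV)
  also have "\<dots> = (\<Sum>i'\<in>UNIV. L $ i $ i' * x $ (i', j))"
    by (intro sum.cong refl) (simp add: if_distrib if_distribR cong: if_cong)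
  finally show ?thesis
    by (simp add: matrix_vector_mult_def)
qed

lemma kron_mat_1_psd:
  assumes "weighted_graph E A"
  shows "0 \<le> x \<bullet> (kron (laplacian A) (mat 1 :: real^'d^'d) *v x)"
proof -
  have "x \<bullet> (kron (laplacian A) (mat 1 :: real^'d^'d) *v x)
      = (\<Sum>i\<in>UNIV. \<Sum>j\<in>UNIV. x $ (i, j) * (laplacian A *v (\<chi> i. x $ (i, j))) $ i)"
    by (simp add: inner_vec_def sum.cartesian_product UNIV_Times_UNIV[symmetric] case_prod_beta
        kron_mat_1_mult_nth[symmetric] del: UNIV_Times_UNIV)
  also have "\<dots> = (\<Sum>j\<in>UNIV. (\<chi> i. x $ (i, j)) \<bullet> (laplacian A *v (\<chi> i. x $ (i, j))))"
    by (subst sum.swap) (simp add: inner_vec_def)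
  also have "\<dots> \<ge> 0"
    by (intro sum_nonneg laplacian_psd[OF assms])
  finally show ?thesis .
qed

lemma kron_mat_1_kernel:
  assumes "weighted_graph E A" "connected_graph E"
  shows "kron (laplacian A) (mat 1 :: real^'d^'d) *v x = 0 \<longleftrightarrow> (\<forall>i j. block x i = block x j)"
proof -
  have "kron (laplacian A) (mat 1 :: real^'d^'d) *v x = 0
      \<longleftrightarrow> (\<forall>j. laplacian A *v (\<chi> i. x $ (i, j)) = 0)"
    by (auto simp: vec_eq_iff kron_mat_1_mult_nth)
  also have "\<dots> \<longleftrightarrow> (\<forall>i j. block x i = block x j)"
    unfolding laplacian_kernel[OF assms] by (auto simp: block_def vec_eq_iff)
  finally show ?thesis .
qed

lemma D_feasible_iff:
  assumes "weighted_graph E A" "connected_graph E"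
  shows "(x, l) \<in> D_feasible (laplacian A) \<longleftrightarrow>
    0 \<le> l \<and> (\<forall>i j. l $ i = l $ j) \<and> (\<forall>i j. block x i = block x j)"
  by (simp add: D_feasible_def laplacian_kernel[OF assms] kron_mat_1_kernel[OF assms])


subsection \<open>Suprema over the samples\<close>

lemma SUP_ereal_eq:
  fixes \<phi> :: "'z \<Rightarrow> real"
  shows "(SUP z. ereal (\<phi> z)) = (if bdd_above (range \<phi>) then ereal (SUP z. \<phi> z) else \<infinity>)"
proof (cases "bdd_above (range \<phi>)")
  case True
  \<comment> \<open>One arbitrary value keeps the supremum away from -\<infinity>.\<close>
  have "ereal (\<phi> undefined) \<le> (SUP z. ereal (\<phi> z))" by (intro SUP_upper) auto
  moreover have "(SUP z. ereal (\<phi> z)) \<le> ereal (SUP z. \<phi> z)"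
    using True by (intro SUP_least) (auto intro: cSUP_upper)
  ultimately have "\<bar>SUP z. ereal (\<phi> z)\<bar> \<noteq> \<infinity>" by auto
  then show ?thesis using True by (simp add: ereal_SUP)
next
  case False
  have "(SUP z. ereal (\<phi> z)) = \<infinity>"
  proof (rule ereal_top)
    fix B
    obtain z where "\<phi> z > B"
      using False by (auto simp: bdd_above_def not_le)
    then show "ereal B \<le> (SUP z. ereal (\<phi> z))"
      by (intro SUP_upper2[of z]) auto
  qed
  then show ?thesis using False by simp
qed

lemma sum_SUP_ereal_eq:
  fixes \<phi> :: "'k::finite \<Rightarrow> 'z \<Rightarrow> real"
  shows "(\<Sum>k\<in>UNIV. SUP z. ereal (\<phi> k z)) =
    (if \<forall>k. bdd_above (range (\<phi> k)) then ereal (\<Sum>k\<in>UNIV. SUP z. \<phi> k z) else \<infinity>)"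
proof (cases "\<forall>k. bdd_above (range (\<phi> k))")
  case False
  then show ?thesis by (auto simp: sum_Pinfty SUP_ereal_eq)
qed (simp add: SUP_ereal_eq)

text \<open>The entries of \<xi> vary independently, so a joint bound controls each term, with the
  other entries frozen, and also the sum of the separate suprema.\<close>

lemma sum_SUP_le_if_bounded:
  fixes \<phi> :: "'k::finite \<Rightarrow> 'z \<Rightarrow> real"
  assumes M: "\<And>\<xi> :: 'z^'k. (\<Sum>k\<in>UNIV. \<phi> k (\<xi> $ k)) \<le> M"
  shows "\<forall>k. bdd_above (range (\<phi> k))" and "(\<Sum>k\<in>UNIV. SUP z. \<phi> k z) \<le> M"
proof -
  show bdd: "\<forall>k. bdd_above (range (\<phi> k))"
  proof
    fix k
    have "\<phi> k z \<le> M - (\<Sum>j\<in>UNIV - {k}. \<phi> j undefined)" for z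
    proof -
      have "(\<Sum>j\<in>UNIV. \<phi> j ((\<chi> j. if j = k then z else undefined) $ j))
          = \<phi> k z + (\<Sum>j\<in>UNIV - {k}. \<phi> j undefined)"
        by (subst sum.remove[of _ k]) auto
      then show ?thesis using M[of "\<chi> j. if j = k then z else undefined"] by linarith
    qed
    then show "bdd_above (range (\<phi> k))" by (intro bdd_aboveI2)
  qed
  show "(\<Sum>k\<in>UNIV. SUP z. \<phi> k z) \<le> M"
  proof (rule field_le_epsilon)
    fix e :: real assume e: "e > 0"
    \<comment> \<open>Near-maximizers within \<open>d\<close> in each of the \<open>CARD('k)\<close>
      terms lose \<open>e\<close> in total.\<close>
    define d where "d = e / real CARD('k)"
    have d: "d > 0" using e by (simp add: d_def)
    have "\<exists>z. (SUP z. \<phi> k z) - d < \<phi> k z" for k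
      using less_cSUP_iff[of UNIV "\<phi> k" "(SUP z. \<phi> k z) - d"] bdd d by auto
    then obtain z where z: "\<And>k. (SUP z. \<phi> k z) - d < \<phi> k (z k)" by metis
    have "(\<Sum>k\<in>UNIV. SUP z. \<phi> k z) \<le> (\<Sum>k\<in>UNIV. \<phi> k ((\<chi> k. z k) $ k) + d)"
      using z by (intro sum_mono) (simp add: less_imp_le algebra_simps)
    also have "\<dots> = (\<Sum>k\<in>UNIV. \<phi> k ((\<chi> k. z k) $ k)) + e"
      by (simp add: sum.distrib d_def)
    also have "\<dots> \<le> M + e" using M[of "\<chi> k. z k"] by (rule add_right_mono)
    finally show "(\<Sum>k\<in>UNIV. SUP z. \<phi> k z) \<le> M + e" .
  qed
qed

lemma convex_on_sum_fun:
  assumes "finite K" "convex S" "\<And>k. k \<in> K \<Longrightarrow> convex_on S (\<phi> k)"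
  shows "convex_on S (\<lambda>p. \<Sum>k\<in>K. \<phi> k p)"
  using assms(1,3) by (induction K) (auto simp: convex_on_const assms(2) intro!: convex_on_add)

lemma convex_on_SUP:
  fixes \<phi> :: "'z \<Rightarrow> 'a::real_vector \<Rightarrow> real"
  assumes \<phi>: "\<And>z. convex_on S (\<phi> z)"
    and bdd: "\<And>p. p \<in> S \<Longrightarrow> bdd_above (range (\<lambda>z. \<phi> z p))"
  shows "convex_on S (\<lambda>p. SUP z. \<phi> z p)"
  unfolding convex_on_def
proof (intro conjI ballI allI impI)
  show "convex S" using convex_on_imp_convex[OF \<phi>] .
  fix p q and s t :: real
  assume pq: "p \<in> S" "q \<in> S" and st: "0 \<le> s" "0 \<le> t" "s + t = 1"
  show "(SUP z. \<phi> z (s *\<^sub>R p + t *\<^sub>R q)) \<le> s * (SUP z. \<phi> z p) + t * (SUP z. \<phi> z q)"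
  proof (rule cSUP_least)
    fix z
    have "\<phi> z (s *\<^sub>R p + t *\<^sub>R q) \<le> s * \<phi> z p + t * \<phi> z q"
      using \<phi>[of z] pq st unfolding convex_on_def by blast
    also have "\<dots> \<le> s * (SUP z. \<phi> z p) + t * (SUP z. \<phi> z q)"
      using st pq bdd by (intro add_mono mult_left_mono cSUP_upper) auto
    finally show "\<phi> z (s *\<^sub>R p + t *\<^sub>R q) \<le> s * (SUP z. \<phi> z p) + t * (SUP z. \<phi> z q)" .
  qed simp
qed

lemma convex_Collect_bdd_above:
  fixes \<phi> :: "'z \<Rightarrow> 'a::real_vector \<Rightarrow> real"
  assumes \<phi>: "\<And>z. convex_on UNIV (\<phi> z)"
  shows "convex {p. bdd_above (range (\<lambda>z. \<phi> z p))}"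
proof (rule convexI)
  fix p q and s t :: real
  assume pq: "p \<in> {p. bdd_above (range (\<lambda>z. \<phi> z p))}" "q \<in> {p. bdd_above (range (\<lambda>z. \<phi> z p))}"
    and st: "0 \<le> s" "0 \<le> t" "s + t = 1"
  then obtain M1 M2 where M: "\<And>z. \<phi> z p \<le> M1" "\<And>z. \<phi> z q \<le> M2"
    by (auto simp: bdd_above_def)
  have "\<phi> z (s *\<^sub>R p + t *\<^sub>R q) \<le> s * M1 + t * M2" for z
  proof -
    have "\<phi> z (s *\<^sub>R p + t *\<^sub>R q) \<le> s * \<phi> z p + t * \<phi> z q"
      using \<phi>[of z] st unfolding convex_on_def by blast
    also have "\<dots> \<le> s * M1 + t * M2"
      using st M by (intro add_mono mult_left_mono) auto
    finally show ?thesis .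
  qed
  then show "s *\<^sub>R p + t *\<^sub>R q \<in> {p. bdd_above (range (\<lambda>z. \<phi> z p))}"
    by (auto intro!: bdd_aboveI2)
qed


subsection \<open>The objective of (D) on its effective domain\<close>

text \<open>The effective domain of \<open>D_objective\<close> within \<lambda> \<ge> 0, phrased by
  boundedness so that real suprema can replace extended-real ones on it.\<close>

definition D_dom :: "((real^'d) \<times> (real^'m) \<Rightarrow> real) \<Rightarrow> real^'m^'N \<Rightarrow> ('N \<Rightarrow> 'n) \<Rightarrow>
    ((real^('n::finite \<times> 'd::finite)) \<times> (real^'n)) set" where
  "D_dom f \<xi>hat v = {(x, l). 0 \<le> l \<and>
     (\<forall>k. bdd_above (range (g f \<xi>hat k (block x (v k)) (l $ v k))))}"

text \<open>Off \<open>D_dom\<close> the real suprema in \<open>D_value\<close> are junk values.\<close>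

definition D_value :: "real \<Rightarrow> ((real^'d) \<times> (real^'m) \<Rightarrow> real) \<Rightarrow> real^'m^'N \<Rightarrow> ('N \<Rightarrow> 'n) \<Rightarrow>
    (real^('n::finite \<times> 'd::finite)) \<times> (real^'n) \<Rightarrow> real" where
  "D_value \<epsilon> f \<xi>hat v = (\<lambda>(x, l). h \<epsilon> l +
     1 / real CARD('N) * (\<Sum>k\<in>UNIV. SUP \<xi>. g f \<xi>hat k (block x (v k)) (l $ v k) \<xi>))"

lemma D_objective_eq:
  assumes "0 \<le> snd p"
  shows "D_objective \<epsilon> f \<xi>hat v p = (if p \<in> D_dom f \<xi>hat v then ereal (D_value \<epsilon> f \<xi>hat v p) else \<infinity>)"
  using assms
  by (cases p) (auto simp: D_objective_def D_dom_def D_value_def sum_SUP_ereal_eq less_eq_vec_def)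

lemma P_objective_finite_iff:
  "\<bar>P_objective \<epsilon> f \<xi>hat (l, x)\<bar> \<noteq> \<infinity> \<longleftrightarrow> (\<forall>k. bdd_above (range (g f \<xi>hat k x l)))"
  unfolding P_objective_def case_prod_conv sum_SUP_ereal_eq by simp

text \<open>The link between (D) and (P): feasible points of (D) are consensus copies of one pair,
  and the division by the number of agents in \<open>h\<close> cancels the number of copies.\<close>

lemma D_objective_consensus:
  assumes "\<And>i. l $ i = c" "\<And>i. block x i = y"
  shows "D_objective \<epsilon> f \<xi>hat v (x, l) = P_objective \<epsilon> f \<xi>hat (c, y)"
proof -
  have "h \<epsilon> l = c * \<epsilon>\<^sup>2"
    using assms(1) by (simp add: h_def inner_vec_def)
  then show ?thesis
    using assms by (simp add: D_objective_def P_objective_def)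
qed

lemma block_simps [simp]:
  "block (x + y) i = block x i + block y i" "block (a *\<^sub>R x) i = a *\<^sub>R block x i"
  by (simp_all add: block_def vec_eq_iff)

lemma continuous_on_block [continuous_intros]:
  "continuous_on S F \<Longrightarrow> continuous_on S (\<lambda>z. block (F z) i)"
  unfolding block_def by (intro continuous_intros)

lemma convex_on_g_block:
  fixes f :: "(real^'d::finite) \<times> (real^'m) \<Rightarrow> real" and i :: "'n::finite"
  assumes "\<And>\<xi>. convex_on UNIV (\<lambda>x. f (x, \<xi>))"
  shows "convex_on UNIV (\<lambda>(x, l). g f \<xi>hat k (block x i) (l $ i) \<xi>)"
  unfolding convex_on_def
proof (intro conjI ballI allI impI)
  fix p q :: "(real^('n \<times> 'd)) \<times> (real^'n)" and s t :: real
  assume st: "0 \<le> s" "0 \<le> t" "s + t = 1"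
  obtain x l y r where eq: "p = (x, l)" "q = (y, r)" by (metis surj_pair)
  have "f (s *\<^sub>R block x i + t *\<^sub>R block y i, \<xi>) \<le> s * f (block x i, \<xi>) + t * f (block y i, \<xi>)"
    using assms[of \<xi>] st unfolding convex_on_def by blast
  then show "(case s *\<^sub>R p + t *\<^sub>R q of (x, l) \<Rightarrow> g f \<xi>hat k (block x i) (l $ i) \<xi>)
      \<le> s * (case p of (x, l) \<Rightarrow> g f \<xi>hat k (block x i) (l $ i) \<xi>)
        + t * (case q of (x, l) \<Rightarrow> g f \<xi>hat k (block x i) (l $ i) \<xi>)"
    by (simp add: eq g_def algebra_simps)
qed simp

text \<open>For fixed \<xi> each \<open>g\<close> is convex in the decision and affine in \<lambda>;
  suprema over \<xi> and nonnegative combinations keep joint convexity.\<close>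

lemma convex_on_D_value:
  fixes f :: "(real^'d::finite) \<times> (real^'m) \<Rightarrow> real" and v :: "'N::finite \<Rightarrow> 'n::finite"
  assumes f: "\<And>\<xi>. convex_on UNIV (\<lambda>x. f (x, \<xi>))"
  shows "convex_on (D_dom f \<xi>hat v) (D_value \<epsilon> f \<xi>hat v)"
proof -
  define \<phi> where "\<phi> k \<xi> = (\<lambda>(x :: real^('n \<times> 'd), l). g f \<xi>hat k (block x (v k)) (l $ v k) \<xi>)" for k \<xi>
  have \<phi>: "convex_on UNIV (\<phi> k \<xi>)" for k \<xi>
    unfolding \<phi>_def by (rule convex_on_g_block[OF f])
  have dom: "D_dom f \<xi>hat v = (UNIV \<times> {l. 0 \<le> l}) \<inter> (\<Inter>k. {p. bdd_above (range (\<lambda>\<xi>. \<phi> k \<xi> p))})"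
    by (auto simp: D_dom_def \<phi>_def)
  have "convex {l :: real^'n. 0 \<le> l}"
    by (auto simp: convex_def less_eq_vec_def)
  then have cd: "convex (D_dom f \<xi>hat v)"
    unfolding dom by (intro convex_Int convex_Times convex_INT convex_Collect_bdd_above \<phi>) auto
  have "convex_on (D_dom f \<xi>hat v) (\<lambda>p. h \<epsilon> (snd p))"
    using cd unfolding convex_on_def
    by (auto simp: h_def inner_add_right distrib_left add_divide_distrib mult.left_commute)
  moreover have "convex_on (D_dom f \<xi>hat v) (\<lambda>p. \<Sum>k\<in>UNIV. SUP \<xi>. \<phi> k \<xi> p)"
    by (intro convex_on_sum_fun convex_on_SUP convex_on_subset[OF \<phi>] cd) (auto simp: dom)
  ultimately have "convex_on (D_dom f \<xi>hat v)
      (\<lambda>p. h \<epsilon> (snd p) + 1 / real CARD('N) * (\<Sum>k\<in>UNIV. SUP \<xi>. \<phi> k \<xi> p))"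
    by (intro convex_on_add convex_on_cmul) auto
  moreover have "(\<lambda>p. h \<epsilon> (snd p) + 1 / real CARD('N) * (\<Sum>k\<in>UNIV. SUP \<xi>. \<phi> k \<xi> p)) = D_value \<epsilon> f \<xi>hat v"
    by (auto simp: D_value_def \<phi>_def)
  ultimately show ?thesis by metis
qed

lemma D_dom_interior_feasible:
  fixes f :: "(real^'d::finite) \<times> (real^'m) \<Rightarrow> real" and v :: "'N::finite \<Rightarrow> 'n::finite"
  assumes G: "weighted_graph E A" "connected_graph E"
    and "interior {(l, x). 0 \<le> l \<and> \<bar>P_objective \<epsilon> f \<xi>hat (l, x)\<bar> \<noteq> \<infinity>} \<noteq> {}"
  obtains p where "p \<in> interior (D_dom f \<xi>hat v)" "p \<in> D_feasible (laplacian A)"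
proof -
  obtain l0 x0 where i: "(l0, x0) \<in> interior {(l, x). 0 \<le> l \<and> \<bar>P_objective \<epsilon> f \<xi>hat (l, x)\<bar> \<noteq> \<infinity>}"
    using assms(3) by auto
  then obtain T where T: "open T" "(l0, x0) \<in> T"
    and sub: "T \<subseteq> {(l, x). 0 \<le> l \<and> \<bar>P_objective \<epsilon> f \<xi>hat (l, x)\<bar> \<noteq> \<infinity>}"
    by (rule interiorE)
  have T': "0 \<le> l \<and> (\<forall>k. bdd_above (range (g f \<xi>hat k x l)))" if "(l, x) \<in> T" for l x
    using subsetD[OF sub that] unfolding mem_Collect_eq case_prod_conv P_objective_finite_iff .
  define x :: "real^('n \<times> 'd)" where "x = (\<chi> q. x0 $ snd q)"
  define l :: "real^'n" where "l = (\<chi> i. l0)"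
  have b: "block x i = x0" for i by (simp add: block_def x_def vec_eq_iff)
  \<comment> \<open>Each agent's own pair lies in \<open>T\<close>, without consensus among the
    agents. Being a finite intersection of open preimages, this is a full neighbourhood of the
    consensus point.\<close>
  define U where "U = (\<Inter>i. (\<lambda>p :: (real^('n \<times> 'd)) \<times> (real^'n). (snd p $ i, block (fst p) i)) -` T)"
  have "open U"
    unfolding U_def by (intro open_INT ballI open_vimage T continuous_intros) simp
  moreover have "(x, l) \<in> U" using T(2) by (simp add: U_def b l_def)
  moreover have "U \<subseteq> D_dom f \<xi>hat v"
  proof
    fix p assume "p \<in> U"
    then have "(snd p $ i, block (fst p) i) \<in> T" for i by (simp add: U_def)
    then show "p \<in> D_dom f \<xi>hat v"
      using T' by (cases p) (auto simp: D_dom_def less_eq_vec_def)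
  qed
  ultimately have "(x, l) \<in> interior (D_dom f \<xi>hat v)" by (rule interiorI)
  moreover have "(x, l) \<in> D_feasible (laplacian A)"
    using T'[OF T(2)] by (simp add: D_feasible_iff[OF G] b l_def less_eq_vec_def)
  ultimately show thesis by (rule that)
qed

lemma D_optimizer_exists:
  fixes f :: "(real^'d::finite) \<times> (real^'m) \<Rightarrow> real" and v :: "'N::finite \<Rightarrow> 'n::finite"
  assumes G: "weighted_graph E A" "connected_graph E"
    and "\<exists>lx. is_arg_min (P_objective \<epsilon> f \<xi>hat) (\<lambda>(l, x). 0 \<le> l) lx"
  obtains p where "D_optimizer \<epsilon> f \<xi>hat v (laplacian A) p"
proof -
  obtain l0 x0 where o: "is_arg_min (P_objective \<epsilon> f \<xi>hat) (\<lambda>(l, x). 0 \<le> l) (l0, x0)"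
    using assms(3) by auto
  define x :: "real^('n \<times> 'd)" where "x = (\<chi> q. x0 $ snd q)"
  define l :: "real^'n" where "l = (\<chi> i. l0)"
  have b: "block x i = x0" for i by (simp add: block_def x_def vec_eq_iff)
  have "(x, l) \<in> D_feasible (laplacian A)"
    using o by (simp add: D_feasible_iff[OF G] b l_def less_eq_vec_def is_arg_min_def)
  moreover have "D_objective \<epsilon> f \<xi>hat v (x, l) \<le> D_objective \<epsilon> f \<xi>hat v p"
    if p: "p \<in> D_feasible (laplacian A)" for p
  proof -
    obtain y r where eq: "p = (y, r)" by (cases p)
    \<comment> \<open>Any agent represents the consensus value.\<close>
    obtain i :: 'n where True by simp
    have c: "\<And>j. r $ j = r $ i" "\<And>j. block y j = block y i" "0 \<le> r $ i"
      using p unfolding eq D_feasible_iff[OF G] by (auto simp: less_eq_vec_def)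
    have "D_objective \<epsilon> f \<xi>hat v (x, l) = P_objective \<epsilon> f \<xi>hat (l0, x0)"
      by (rule D_objective_consensus) (simp_all add: b l_def)
    also have "\<dots> \<le> P_objective \<epsilon> f \<xi>hat (r $ i, block y i)"
      using o c(3) by (auto simp: is_arg_min_linorder)
    also have "\<dots> = D_objective \<epsilon> f \<xi>hat v p"
      unfolding eq by (rule D_objective_consensus[symmetric]) (use c in auto)
    finally show ?thesis .
  qed
  ultimately have "D_optimizer \<epsilon> f \<xi>hat v (laplacian A) (x, l)"
    unfolding D_optimizer_def is_arg_min_linorder by blast
  then show thesis by (rule that)
qed


subsection \<open>Augmented Lagrangians\<close>

lemma coupling_feasible:
  assumes "(x, l) \<in> D_feasible L"
  shows "coupling L x l \<nu> \<eta> = 0"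
  using assms by (simp add: D_feasible_def coupling_def)

lemma L_aug_feasible:
  assumes "p \<in> D_feasible L"
  shows "L_aug \<epsilon> f \<xi>hat v L p q = D_objective \<epsilon> f \<xi>hat v p"
  using assms by (cases p; cases q) (simp add: L_aug_def coupling_feasible flip: zero_ereal_def)

lemma D_optimizer_imp_saddle_L_aug:
  fixes f :: "(real^'d::finite) \<times> (real^'m) \<Rightarrow> real" and v :: "'N::finite \<Rightarrow> 'n::finite"
  assumes G: "weighted_graph E A" "connected_graph E"
    and f: "\<And>\<xi>. convex_on UNIV (\<lambda>x. f (x, \<xi>))"
    and int: "interior {(l, x). 0 \<le> l \<and> \<bar>P_objective \<epsilon> f \<xi>hat (l, x)\<bar> \<noteq> \<infinity>} \<noteq> {}"
    and opt: "D_optimizer \<epsilon> f \<xi>hat v (laplacian A) p"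
  obtains q where
    "(p, q) \<in> saddle_points (L_aug \<epsilon> f \<xi>hat v (laplacian A)) (UNIV \<times> {l. 0 \<le> l}) UNIV"
    and "p \<in> D_dom f \<xi>hat v"
proof -
  let ?L = "laplacian A" and ?K = "kron (laplacian A) (mat 1 :: real^'d^'d)"
  let ?D = "D_dom f \<xi>hat v :: ((real^('n \<times> 'd)) \<times> (real^'n)) set"
  let ?F = "D_value \<epsilon> f \<xi>hat v"
  have feas: "p \<in> D_feasible ?L"
    and le: "\<And>p'. p' \<in> D_feasible ?L \<Longrightarrow> D_objective \<epsilon> f \<xi>hat v p \<le> D_objective \<epsilon> f \<xi>hat v p'"
    using opt unfolding D_optimizer_def is_arg_min_linorder by auto
  have nonneg: "0 \<le> snd p'" if "p' \<in> D_feasible ?L" for p' :: "(real^('n \<times> 'd)) \<times> (real^'n)"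
    using that by (auto simp: D_feasible_def)
  obtain p0 where p0: "p0 \<in> interior ?D" "p0 \<in> D_feasible ?L"
    using D_dom_interior_feasible[OF G int] by blast
  have p0D: "p0 \<in> ?D" using p0(1) interior_subset by blast
  \<comment> \<open>The Slater point \<open>p0\<close> has a finite value, so the optimal value is
    finite.\<close>
  have pD: "p \<in> ?D"
  proof (rule ccontr)
    assume "p \<notin> ?D"
    then show False
      using le[OF p0(2)] p0D
      by (simp add: D_objective_eq nonneg feas p0(2))
  qed
  \<comment> \<open>The decision constraint comes first, so the multiplier splits as (\<eta>,
    \<nu>), in the reverse of the order used by \<open>L_aug\<close>.\<close>
  define B where "B p = (?K *v fst p, ?L *v snd p)" for p :: "(real^('n \<times> 'd)) \<times> (real^'n)"
  have "linear B"
    unfolding B_def by (intro linearI)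
      (simp_all add: matrix_vector_right_distrib matrix_vector_mult_scaleR)
  moreover have B0: "B p' = 0 \<longleftrightarrow> ?K *v fst p' = 0 \<and> ?L *v snd p' = 0" for p'
    by (simp add: B_def zero_prod_def)
  have "B p0 = 0"
    unfolding B0 using p0(2) by (auto simp: D_feasible_def)
  moreover have "?F p \<le> ?F p'" if "p' \<in> ?D" "B p' = 0" for p'
  proof -
    have "p' \<in> D_feasible ?L"
      using that by (cases p') (auto simp: B0 D_feasible_def D_dom_def)
    from le[OF this] show ?thesis
      using that pD by (simp add: D_objective_eq nonneg feas \<open>p' \<in> D_feasible ?L\<close>)
  qed
  ultimately obtain y where y: "\<And>p'. p' \<in> ?D \<Longrightarrow> ?F p \<le> ?F p' + y \<bullet> B p'"
    using lagrange_multiplier_exists[of B ?D ?F p0 "?F p"] convex_on_D_value[OF f] p0(1) by blast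
  obtain \<eta> \<nu> where eq: "y = (\<eta>, \<nu>)" by (cases y)
  \<comment> \<open>Independence of the multipliers makes the maximality half of the saddle
    inequality an equality.\<close>
  have at_p: "L_aug \<epsilon> f \<xi>hat v ?L p q = ereal (?F p)" for q
    using feas pD nonneg[OF feas] by (simp add: L_aug_feasible D_objective_eq)
  have "ereal (?F p) \<le> L_aug \<epsilon> f \<xi>hat v ?L p' (\<nu>, \<eta>)" if "p' \<in> UNIV \<times> {l. 0 \<le> l}" for p'
  proof (cases "p' \<in> ?D")
    case True
    obtain x' l' where p': "p' = (x', l')" by (cases p')
    have "?F p \<le> ?F p' + (\<eta> \<bullet> (?K *v x') + \<nu> \<bullet> (?L *v l'))"
      using y[OF True] by (simp add: eq B_def p' inner_prod_def)
    also have "\<dots> \<le> ?F p' + coupling ?L x' l' \<nu> \<eta>"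
      using laplacian_psd[OF G(1), of l'] kron_mat_1_psd[OF G(1), of x']
      by (simp add: coupling_def)
    finally show ?thesis
      using True that by (simp add: L_aug_def p' D_objective_eq)
  next
    case False
    then show ?thesis
      using that by (cases p') (simp add: L_aug_def D_objective_eq)
  qed
  then have "(p, (\<nu>, \<eta>)) \<in> saddle_points (L_aug \<epsilon> f \<xi>hat v ?L) (UNIV \<times> {l. 0 \<le> l}) UNIV"
    using nonneg[OF feas] by (auto simp: saddle_points_iff at_p mem_Times_iff)
  then show thesis using pD by (rule that)
qed

lemma Ltilde_aug_le_L_aug:
  fixes f :: "(real^'d::finite) \<times> (real^'m) \<Rightarrow> real" and v :: "'N::finite \<Rightarrow> 'n::finite"
    and \<xi> :: "real^'m^'N"
  assumes "0 \<le> snd p"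
  shows "ereal (Ltilde_aug \<epsilon> f \<xi>hat v L p (\<nu>, \<eta>, \<xi>)) \<le> L_aug \<epsilon> f \<xi>hat v L p (\<nu>, \<eta>)"
proof (cases "p \<in> D_dom f \<xi>hat v")
  case True
  obtain x l where p: "p = (x, l)" by (cases p)
  have "(\<Sum>k\<in>UNIV. g f \<xi>hat k (block x (v k)) (l $ v k) (\<xi> $ k))
      \<le> (\<Sum>k\<in>UNIV. SUP \<xi>. g f \<xi>hat k (block x (v k)) (l $ v k) \<xi>)"
    using True by (intro sum_mono cSUP_upper) (auto simp: D_dom_def p)
  then show ?thesis
    using True assms
    by (simp add: L_aug_def Ltilde_aug_def p D_objective_eq D_value_def divide_right_mono)
next
  case False
  then show ?thesis
    using assms by (cases p) (simp add: L_aug_def D_objective_eq)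
qed

text \<open>With the preceding lemma this makes \<open>L_aug\<close> the supremum of
  \<open>Ltilde_aug\<close> over \<xi>. A real bound \<open>M\<close> also forces \<open>p\<close>
  into \<open>D_dom\<close>, so the estimate can be done in the reals.\<close>

lemma L_aug_le_if_Ltilde_aug_le:
  fixes f :: "(real^'d::finite) \<times> (real^'m) \<Rightarrow> real" and v :: "'N::finite \<Rightarrow> 'n::finite"
  assumes p: "0 \<le> snd p" and M: "\<And>\<xi>. Ltilde_aug \<epsilon> f \<xi>hat v L p (\<nu>, \<eta>, \<xi> :: real^'m^'N) \<le> M"
  shows "L_aug \<epsilon> f \<xi>hat v L p (\<nu>, \<eta>) \<le> ereal M"
proof -
  obtain x l where eq: "p = (x, l)" by (cases p)
  define M' where "M' = real CARD('N) * (M - h \<epsilon> l - coupling L x l \<nu> \<eta>)"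
  have "(\<Sum>k\<in>UNIV. g f \<xi>hat k (block x (v k)) (l $ v k) (\<xi> $ k)) \<le> M'" for \<xi> :: "real^'m^'N"
    using M[of \<xi>] by (simp add: M'_def Ltilde_aug_def eq field_simps)
  note S = sum_SUP_le_if_bounded[of "\<lambda>k. g f \<xi>hat k (block x (v k)) (l $ v k)", OF this]
  have "(x, l) \<in> D_dom f \<xi>hat v"
    using p S(1) by (auto simp: D_dom_def eq)
  moreover have "D_value \<epsilon> f \<xi>hat v (x, l) + coupling L x l \<nu> \<eta> \<le> M"
    using S(2) by (simp add: D_value_def M'_def field_simps)
  ultimately show ?thesis
    using p by (simp add: L_aug_def eq D_objective_eq)
qed

lemma continuous_on_Ltilde_aug:
  fixes f :: "(real^'d::finite) \<times> (real^'m) \<Rightarrow> real" and v :: "'N::finite \<Rightarrow> 'n::finite"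
    and F :: "'z::topological_space \<Rightarrow> (real^('n \<times> 'd)) \<times> (real^'n)"
    and H :: "'z \<Rightarrow> (real^'n) \<times> (real^('n \<times> 'd)) \<times> (real^'m^'N)"
  assumes f: "continuous_on UNIV f" and F: "continuous_on S F" and H: "continuous_on S H"
  shows "continuous_on S (\<lambda>z. Ltilde_aug \<epsilon> f \<xi>hat v L (F z) (H z))"
proof -
  have mv: "continuous_on S (\<lambda>z. M *v u z)" if "continuous_on S u"
    for M :: "real^'a^'b" and u :: "'z \<Rightarrow> real^'a"
    by (rule bounded_linear.continuous_on[OF matrix_vector_mul_bounded_linear that])
  show ?thesis
    unfolding Ltilde_aug_def g_def h_def coupling_def case_prod_beta
    by (intro continuous_intros mv F H continuous_on_compose2[OF f]) auto
qed


text \<open>\<open>coupling\<close> is affine in the multipliers: shifting them by the constraint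
  residuals raises the value by the squared norms of the residuals, which maximality forces to
  vanish.\<close>

lemma feasible_if_Ltilde_aug_maximal:
  fixes f :: "(real^'d::finite) \<times> (real^'m) \<Rightarrow> real" and v :: "'N::finite \<Rightarrow> 'n::finite"
    and \<xi>hat :: "real^'m^'N"
  assumes p: "0 \<le> snd p"
    and max: "\<And>q. Ltilde_aug \<epsilon> f \<xi>hat v L p q \<le> Ltilde_aug \<epsilon> f \<xi>hat v L p q0"
  shows "p \<in> D_feasible L"
proof -
  obtain x l where eq: "p = (x, l)" by (cases p)
  obtain \<nu> \<eta> \<xi> where q0: "q0 = (\<nu>, \<eta>, \<xi>)" by (metis surj_pair)
  let ?K = "kron L (mat 1 :: real^'d^'d)"
  have "(L *v l) \<bullet> (L *v l) + (?K *v x) \<bullet> (?K *v x) \<le> 0"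
    using max[of "(\<nu> + L *v l, \<eta> + ?K *v x, \<xi>)"]
    by (simp add: Ltilde_aug_def eq q0 coupling_def inner_add_left)
  then have "(L *v l) \<bullet> (L *v l) = 0" "(?K *v x) \<bullet> (?K *v x) = 0"
    using inner_ge_zero[of "L *v l"] inner_ge_zero[of "?K *v x"] by linarith+
  then show ?thesis using p by (simp add: eq D_feasible_def)
qed


subsection \<open>Attainment of the maximum over the samples\<close>

text \<open>A concave function grows at most linearly away from \<xi>0, so the quadratic term
  dominates far out.\<close>

lemma bounded_superlevel_concave_minus_square:
  fixes \<psi> :: "'a::euclidean_space \<Rightarrow> real"
  assumes conc: "concave_on UNIV \<psi>" and cont: "continuous_on UNIV \<psi>" and c: "c > 0"
  shows "bounded {\<xi>. \<alpha> \<le> \<psi> \<xi> - c * (norm (\<xi> - \<xi>0))\<^sup>2}"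
proof -
  have "compact (\<psi> ` cball \<xi>0 1)"
    by (intro compact_continuous_image continuous_on_subset[OF cont]) auto
  then have "bdd_above (\<psi> ` cball \<xi>0 1)"
    by (intro bounded_imp_bdd_above compact_imp_bounded)
  then obtain M where M: "\<And>\<xi>. \<xi> \<in> cball \<xi>0 1 \<Longrightarrow> \<psi> \<xi> \<le> M"
    unfolding bdd_above_def by blast
  \<comment> \<open>Dividing the final estimate by \<open>c * r\<close>, with the constant term
    absorbed through \<open>r > 1\<close>, gives this radius.\<close>
  define R where "R = (M - \<psi> \<xi>0 + \<bar>\<psi> \<xi>0 - \<alpha>\<bar>) / c"
  have "norm (\<xi> - \<xi>0) \<le> max 1 R" if \<xi>: "\<alpha> \<le> \<psi> \<xi> - c * (norm (\<xi> - \<xi>0))\<^sup>2" for \<xi>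
  proof (cases "norm (\<xi> - \<xi>0) \<le> 1")
    case False
    define r where "r = norm (\<xi> - \<xi>0)"
    have r: "r > 1" using False by (simp add: r_def)
    \<comment> \<open>The convex combination is the point where the segment from \<xi>0 to \<xi>
      meets the unit sphere around \<xi>0.\<close>
    have "(1 - 1 / r) * \<psi> \<xi>0 + 1 / r * \<psi> \<xi> \<le> \<psi> ((1 - 1 / r) *\<^sub>R \<xi>0 + (1 / r) *\<^sub>R \<xi>)"
      using r by (intro concave_onD[OF conc]) auto
    also have "\<dots> \<le> M"
    proof (rule M)
      have "(1 - 1 / r) *\<^sub>R \<xi>0 + (1 / r) *\<^sub>R \<xi> = \<xi>0 + (1 / r) *\<^sub>R (\<xi> - \<xi>0)"
        by (simp add: algebra_simps)
      then show "(1 - 1 / r) *\<^sub>R \<xi>0 + (1 / r) *\<^sub>R \<xi> \<in> cball \<xi>0 1"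
        using r by (simp add: dist_norm r_def)
    qed
    finally have "r * ((1 - 1 / r) * \<psi> \<xi>0 + 1 / r * \<psi> \<xi>) \<le> r * M"
      using r by (intro mult_left_mono) auto
    then have "\<psi> \<xi> \<le> r * (M - \<psi> \<xi>0) + \<psi> \<xi>0"
      using r by (simp add: algebra_simps)
    then have "c * r\<^sup>2 \<le> r * (M - \<psi> \<xi>0) + (\<psi> \<xi>0 - \<alpha>)"
      using \<xi> by (simp add: r_def)
    also have "\<dots> \<le> r * (M - \<psi> \<xi>0) + r * \<bar>\<psi> \<xi>0 - \<alpha>\<bar>"
    proof (rule add_left_mono)
      have "\<psi> \<xi>0 - \<alpha> \<le> 1 * \<bar>\<psi> \<xi>0 - \<alpha>\<bar>" by simp
      also have "\<dots> \<le> r * \<bar>\<psi> \<xi>0 - \<alpha>\<bar>" using r by (intro mult_right_mono) auto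
      finally show "\<psi> \<xi>0 - \<alpha> \<le> r * \<bar>\<psi> \<xi>0 - \<alpha>\<bar>" .
    qed
    finally have "r * (c * r) \<le> r * (M - \<psi> \<xi>0 + \<bar>\<psi> \<xi>0 - \<alpha>\<bar>)"
      by (simp add: power2_eq_square algebra_simps)
    then have "c * r \<le> M - \<psi> \<xi>0 + \<bar>\<psi> \<xi>0 - \<alpha>\<bar>"
      using r by simp
    then have "r \<le> R"
      using c by (simp add: R_def field_simps)
    then show ?thesis by (simp add: r_def)
  qed simp
  then show ?thesis
    by (auto intro!: bounded_subset[OF bounded_cball[of \<xi>0 "max 1 R"]] simp: dist_norm norm_minus_commute)
qed

lemma bounded_superlevel_Ltilde_aug:
  fixes f :: "(real^'d::finite) \<times> (real^'m) \<Rightarrow> real" and v :: "'N::finite \<Rightarrow> 'n::finite"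
    and \<xi>hat :: "real^'m^'N" and C :: "((real^('n \<times> 'd)) \<times> (real^'n)) set"
  assumes f: "continuous_on UNIV f" and p: "p \<in> interior C"
    and conc: "\<And>p. p \<in> C \<Longrightarrow> concave_on UNIV (\<lambda>q. Ltilde_aug \<epsilon> f \<xi>hat v L p q)"
  shows "bounded {\<xi>. \<alpha> \<le> Ltilde_aug \<epsilon> f \<xi>hat v L p (\<nu>, \<eta>, \<xi>)}"
proof -
  obtain x l where eq: "p = (x, l)" by (cases p)
  obtain e where e: "e > 0" "cball p e \<subseteq> C"
    using p by (auto simp: mem_interior_cball)
  \<comment> \<open>Lowering every \<lambda> by \<delta> moves \<open>p\<close> by exactly
    \<open>e\<close>, hence to a point of the closed ball in \<open>C\<close>.\<close>
  define \<delta> where "\<delta> = e / norm (1 :: real^'n)"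
  have n1: "norm (1 :: real^'n) > 0" by simp
  have \<delta>: "\<delta> > 0" "\<delta> * norm (1 :: real^'n) = e"
    using e(1) n1 by (simp_all add: \<delta>_def)
  define p' where "p' = (x, l - \<delta> *\<^sub>R 1)"
  have "p' \<in> C"
    using e(2) \<delta> e(1) by (auto simp: p'_def eq dist_norm norm_prod_def)
  define \<psi> where "\<psi> \<xi> = Ltilde_aug \<epsilon> f \<xi>hat v L p' (\<nu>, \<eta>, \<xi>)" for \<xi>
  \<comment> \<open>The values at \<open>p\<close> and \<open>p'\<close> differ by the quadratic
    term and a constant; the constant is read off at \<open>\<xi>hat\<close>, where the quadratic
    term vanishes.\<close>
  define K where "K = Ltilde_aug \<epsilon> f \<xi>hat v L p (\<nu>, \<eta>, \<xi>hat) - \<psi> \<xi>hat"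
  have conc\<psi>: "concave_on UNIV \<psi>"
    unfolding concave_on_iff
  proof (intro conjI ballI allI impI)
    fix \<xi> \<zeta> :: "real^'m^'N" and s t :: real
    assume st: "0 \<le> s" "0 \<le> t" "s + t = 1"
    have "s *\<^sub>R (\<nu>, \<eta>, \<xi>) + t *\<^sub>R (\<nu>, \<eta>, \<zeta>) = (\<nu>, \<eta>, s *\<^sub>R \<xi> + t *\<^sub>R \<zeta>)"
      using st by (simp flip: scaleR_left_distrib)
    then show "s * \<psi> \<xi> + t * \<psi> \<zeta> \<le> \<psi> (s *\<^sub>R \<xi> + t *\<^sub>R \<zeta>)"
      using conc[OF \<open>p' \<in> C\<close>] st unfolding concave_on_iff \<psi>_def by (metis UNIV_I)
  qed simp
  have cont: "continuous_on UNIV \<psi>"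
    unfolding \<psi>_def by (intro continuous_on_Ltilde_aug f continuous_intros)
  have "Ltilde_aug \<epsilon> f \<xi>hat v L p (\<nu>, \<eta>, \<xi>)
      = \<psi> \<xi> - \<delta> / real CARD('N) * (norm (\<xi> - \<xi>hat))\<^sup>2 + K" for \<xi>
  proof -
    have "(norm (\<xi> - \<xi>hat))\<^sup>2 = (\<Sum>k\<in>UNIV. (norm (\<xi> $ k - \<xi>hat $ k))\<^sup>2)"
      unfolding power2_norm_eq_inner by (simp add: inner_vec_def)
    then show ?thesis
      by (simp add: K_def \<psi>_def p'_def eq Ltilde_aug_def g_def sum_subtractf sum.distrib
          left_diff_distrib sum_distrib_left diff_divide_distrib add_divide_distrib)
         (simp add: sum_divide_distrib)
  qed
  then have "{\<xi>. \<alpha> \<le> Ltilde_aug \<epsilon> f \<xi>hat v L p (\<nu>, \<eta>, \<xi>)}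
      = {\<xi>. \<alpha> - K \<le> \<psi> \<xi> - \<delta> / real CARD('N) * (norm (\<xi> - \<xi>hat))\<^sup>2}"
    by auto
  then show ?thesis
    using bounded_superlevel_concave_minus_square[OF conc\<psi> cont, of "\<delta> / real CARD('N)"] \<delta>(1) by simp
qed

text \<open>The premise on \<open>m\<close> says, in real terms, that \<open>m\<close> is at most
  the supremum over \<xi> of the infimum over \<open>C\<close>. The near-maximizers form nested
  nonempty compact sets, whose common point attains \<open>m\<close>.\<close>

lemma Ltilde_aug_sample_attained:
  fixes f :: "(real^'d::finite) \<times> (real^'m) \<Rightarrow> real" and v :: "'N::finite \<Rightarrow> 'n::finite"
    and \<xi>hat :: "real^'m^'N" and C :: "((real^('n \<times> 'd)) \<times> (real^'n)) set"
  assumes f: "continuous_on UNIV f" and C: "interior C \<noteq> {}"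
    and conc: "\<And>p. p \<in> C \<Longrightarrow> concave_on UNIV (\<lambda>q. Ltilde_aug \<epsilon> f \<xi>hat v L p q)"
    and m: "\<And>m'. m' < m \<Longrightarrow> \<exists>\<xi>. \<forall>p\<in>C. m' \<le> Ltilde_aug \<epsilon> f \<xi>hat v L p (\<nu>, \<eta>, \<xi>)"
  obtains \<xi> where "\<And>p. p \<in> C \<Longrightarrow> m \<le> Ltilde_aug \<epsilon> f \<xi>hat v L p (\<nu>, \<eta>, \<xi>)"
proof -
  define K where "K n = {\<xi>. \<forall>p\<in>C. m - inverse (real (Suc n)) \<le> Ltilde_aug \<epsilon> f \<xi>hat v L p (\<nu>, \<eta>, \<xi>)}"
    for n :: nat
  obtain p1 where p1: "p1 \<in> interior C" using C by auto
  have K_Int: "K n = (\<Inter>p\<in>C. {\<xi>. m - inverse (real (Suc n)) \<le> Ltilde_aug \<epsilon> f \<xi>hat v L p (\<nu>, \<eta>, \<xi>)})" for n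
    by (auto simp: K_def)
  have "closed (K n)" for n
    unfolding K_Int
    by (intro closed_INT ballI closed_Collect_le continuous_on_Ltilde_aug f continuous_intros)
  moreover have "bounded (K n)" for n
    \<comment> \<open>\<open>p1\<close> itself lies in \<open>C\<close>, so \<open>K n\<close> is
      contained in the single superlevel set at \<open>p1\<close>.\<close>
    using p1 interior_subset
    by (intro bounded_subset[OF bounded_superlevel_Ltilde_aug[OF f p1 conc]]) (auto simp: K_def)
  ultimately have "compact (K n)" for n
    by (simp add: compact_eq_bounded_closed)
  moreover have "K n \<noteq> {}" for n
    using m[of "m - inverse (real (Suc n))"] by (auto simp: K_def)
  moreover have "K j \<subseteq> K i" if "i \<le> j" for i j
  proof -
    have "m - inverse (real (Suc i)) \<le> m - inverse (real (Suc j))"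
      using that by (intro diff_left_mono le_imp_inverse_le) auto
    then show ?thesis unfolding K_def by (blast intro: order_trans)
  qed
  ultimately have "\<Inter>(range K) \<noteq> {}"
    by (rule compact_nest)
  then obtain \<xi> where \<xi>: "\<And>n. \<xi> \<in> K n"
    by auto
  have "m \<le> Ltilde_aug \<epsilon> f \<xi>hat v L p (\<nu>, \<eta>, \<xi>)" if "p \<in> C" for p
  proof (rule field_le_epsilon)
    fix e :: real assume "e > 0"
    then obtain n where "inverse (real (Suc n)) < e" using reals_Archimedean by blast
    then show "m \<le> Ltilde_aug \<epsilon> f \<xi>hat v L p (\<nu>, \<eta>, \<xi>) + e"
      using \<xi>[of n] that by (force simp: K_def)
  qed
  then show thesis by (rule that)
qed


subsection \<open>Saddle points and optimizers\<close>

theorem propositionV5: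
  fixes \<epsilon> :: real
    and E :: "('n::finite \<times> 'n) set"
    and A :: "real^'n^'n"
    and L :: "real^'n^'n"
    and \<xi>hat :: "real^'m^'N"
    and v :: "'N::finite \<Rightarrow> 'n"
    and f :: "(real^'d::finite) \<times> (real^'m) \<Rightarrow> real"
    and C :: "((real^('n \<times> 'd)) \<times> (real^'n)) set"
  assumes "L = laplacian A"
    and "\<epsilon> \<ge> 0"
    and "weighted_graph E A" and "connected_graph E"
    and "surj v"
    and "continuously_differentiable f"
    and "\<And>\<xi>. convex_on UNIV (\<lambda>x. f (x, \<xi>))"
    and "\<And>x. convex_on UNIV (\<lambda>\<xi>. f (x, \<xi>)) \<or> concave_on UNIV (\<lambda>\<xi>. f (x, \<xi>))"
    and "closure {\<xi>. \<not> recession_direction (\<lambda>x. f (x, \<xi>)) 1 \<and>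
                     \<not> recession_direction (\<lambda>x. f (x, \<xi>)) (- 1)} = UNIV"
    and "interior {(l, x). 0 \<le> l \<and> \<bar>P_objective \<epsilon> f \<xi>hat (l, x)\<bar> \<noteq> \<infinity>} \<noteq> {}"
    and "\<exists>lx. is_arg_min (P_objective \<epsilon> f \<xi>hat) (\<lambda>(l, x). 0 \<le> l) lx"
    and "C \<subseteq> UNIV \<times> {l. 0 \<le> l}" and "closed C" and "convex C" and "interior C \<noteq> {}"
    and "saddle_points (L_aug \<epsilon> f \<xi>hat v L) (UNIV \<times> {l. 0 \<le> l}) UNIV \<subseteq> C \<times> UNIV"
    and "\<And>q. convex_on C (\<lambda>p. Ltilde_aug \<epsilon> f \<xi>hat v L p q)"
    and "\<And>p. p \<in> C \<Longrightarrow> concave_on UNIV (\<lambda>q. Ltilde_aug \<epsilon> f \<xi>hat v L p q)"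
    and "\<And>\<nu> \<eta>. (INF p\<in>C. SUP \<xi>. ereal (Ltilde_aug \<epsilon> f \<xi>hat v L p (\<nu>, \<eta>, \<xi>)))
               = (SUP \<xi>. INF p\<in>C. ereal (Ltilde_aug \<epsilon> f \<xi>hat v L p (\<nu>, \<eta>, \<xi>)))"
  shows "(saddle_points (Ltilde_aug \<epsilon> f \<xi>hat v L) C UNIV \<noteq> {} \<and>
          convex (saddle_points (Ltilde_aug \<epsilon> f \<xi>hat v L) C UNIV) \<and>
          closed (saddle_points (Ltilde_aug \<epsilon> f \<xi>hat v L) C UNIV)) \<and>
         (\<forall>p q. (p, q) \<in> saddle_points (Ltilde_aug \<epsilon> f \<xi>hat v L) C UNIV
            \<longrightarrow> D_optimizer \<epsilon> f \<xi>hat v L p) \<and>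
         (\<forall>p\<in>C. D_optimizer \<epsilon> f \<xi>hat v L p
            \<longrightarrow> (\<exists>q. (p, q) \<in> saddle_points (Ltilde_aug \<epsilon> f \<xi>hat v L) C UNIV))"
proof -
  note L = assms(1) and G = assms(3,4) and fcvx = assms(7) and P_int = assms(10) and P_opt = assms(11)
    and C = assms(12-15) and saddle_C = assms(16) and Lcvx = assms(17) and Lconc = assms(18)
    and minimax = assms(19)
  let ?Lt = "Ltilde_aug \<epsilon> f \<xi>hat v L" and ?La = "L_aug \<epsilon> f \<xi>hat v L"
    and ?F = "D_objective \<epsilon> f \<xi>hat v"
  have nonneg: "0 \<le> snd p" if "p \<in> C" for p
    using C(1) that by auto
  have f: "continuous_on UNIV f"
    using assms(6) unfolding continuously_differentiable_def
    by (meson continuous_at_imp_continuous_on has_derivative_continuous)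

  \<comment> \<open>Membership in \<open>C\<close> is derived here from hypothesis (i), for any
    optimizer of (D). This serves claims (i) and (iii), and supplies the comparison point for
    (ii).\<close>
  have optimizer: "p \<in> C \<and> (\<exists>q. (p, q) \<in> saddle_points ?Lt C UNIV)"
    if opt: "D_optimizer \<epsilon> f \<xi>hat v L p" for p
  proof -
    obtain \<nu> \<eta> where sp: "(p, \<nu>, \<eta>) \<in> saddle_points ?La (UNIV \<times> {l. 0 \<le> l}) UNIV"
      and dom: "p \<in> D_dom f \<xi>hat v"
      using D_optimizer_imp_saddle_L_aug[OF G fcvx P_int] opt unfolding L by (metis surj_pair)
    have pC: "p \<in> C" using saddle_C sp by auto
    have feas: "p \<in> D_feasible L"
      using opt by (simp add: D_optimizer_def is_arg_min_def)
    define m where "m = D_value \<epsilon> f \<xi>hat v p"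
    have at_p: "?La p q = ereal m" for q
      using dom nonneg[OF pC] by (simp add: L_aug_feasible[OF feas] D_objective_eq m_def)
    have "ereal m \<le> (SUP \<xi>. ereal (?Lt p' (\<nu>, \<eta>, \<xi>)))" if p': "p' \<in> C" for p'
    \<comment> \<open>The supremum may be infinite, so it is tested against its real upper bounds
      only.\<close>
    proof (rule ereal_le_real)
      fix M assume M: "(SUP \<xi>. ereal (?Lt p' (\<nu>, \<eta>, \<xi>))) \<le> ereal M"
      have "ereal m \<le> ?La p' (\<nu>, \<eta>)"
        using sp C(1) p' unfolding at_p[of "(\<nu>, \<eta>)", symmetric] saddle_points_iff by blast
      also have "\<dots> \<le> ereal M"
        using M by (intro L_aug_le_if_Ltilde_aug_le nonneg p') (simp add: SUP_le_iff)
      finally show "ereal m \<le> ereal M" .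
    qed
    then have m: "ereal m \<le> (SUP \<xi>. INF p\<in>C. ereal (?Lt p (\<nu>, \<eta>, \<xi>)))"
      unfolding minimax[symmetric] by (rule INF_greatest)
    have "\<exists>\<xi>. \<forall>p\<in>C. m' \<le> ?Lt p (\<nu>, \<eta>, \<xi>)" if "m' < m" for m'
    proof -
      have "ereal m' < (SUP \<xi>. INF p\<in>C. ereal (?Lt p (\<nu>, \<eta>, \<xi>)))"
        using that by (intro less_le_trans[OF _ m]) simp
      then obtain \<xi> where "ereal m' < (INF p\<in>C. ereal (?Lt p (\<nu>, \<eta>, \<xi>)))"
        by (auto simp: less_SUP_iff)
      from order_trans[OF less_imp_le[OF this] INF_lower]
      have "ereal m' \<le> ereal (?Lt p (\<nu>, \<eta>, \<xi>))" if "p \<in> C" for p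
        using that .
      then show ?thesis unfolding ereal_less_eq by blast
    qed
    then obtain \<xi> where \<xi>: "\<And>p'. p' \<in> C \<Longrightarrow> m \<le> ?Lt p' (\<nu>, \<eta>, \<xi>)"
      using Ltilde_aug_sample_attained[OF f C(4) Lconc] by blast
    \<comment> \<open>The value \<open>m\<close> now separates the two sides: every value at
      \<open>p\<close> is at most \<open>m\<close>, and every value at (\<nu>, \<eta>, \<xi>) over
      \<open>C\<close> is at least \<open>m\<close>.\<close>
    have "?Lt p q \<le> m" for q
      using Ltilde_aug_le_L_aug[OF nonneg[OF pC], of \<epsilon> f \<xi>hat v L "fst q" "fst (snd q)" "snd (snd q)"]
      by (simp add: at_p)
    then have "(p, \<nu>, \<eta>, \<xi>) \<in> saddle_points ?Lt C UNIV"
      using pC \<xi> unfolding saddle_points_iff by (blast intro: order_trans)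
    with pC show ?thesis by blast
  qed
  obtain ps where ps: "D_optimizer \<epsilon> f \<xi>hat v L ps"
    using D_optimizer_exists[OF G P_opt] unfolding L by blast

  have "saddle_points ?Lt C UNIV \<noteq> {}"
    using optimizer[OF ps] by blast
  moreover have "convex (saddle_points ?Lt C UNIV)"
    by (intro convex_saddle_points C Lcvx Lconc convex_UNIV)
  moreover have "closed (saddle_points ?Lt C UNIV)"
    by (intro closed_saddle_points C closed_UNIV continuous_on_Ltilde_aug f continuous_intros)
  moreover have "D_optimizer \<epsilon> f \<xi>hat v L p" if sp: "(p, q) \<in> saddle_points ?Lt C UNIV" for p q
  proof -
    obtain \<nu> \<eta> \<xi> where q: "q = (\<nu>, \<eta>, \<xi>)" by (metis surj_pair)
    have pC: "p \<in> C" and le: "\<And>p' q'. p' \<in> C \<Longrightarrow> ?Lt p q' \<le> ?Lt p' q"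
      using sp by (auto simp: saddle_points_iff)
    have psC: "ps \<in> C" and psF: "ps \<in> D_feasible L"
      and min: "\<And>p'. p' \<in> D_feasible L \<Longrightarrow> ?F ps \<le> ?F p'"
      using optimizer[OF ps] ps unfolding D_optimizer_def is_arg_min_linorder by auto
    have feas: "p \<in> D_feasible L"
      by (rule feasible_if_Ltilde_aug_maximal[OF nonneg[OF pC] le[OF pC]])
    have "?F p = ?La p (\<nu>, \<eta>)"
      by (simp add: L_aug_feasible[OF feas])
    \<comment> \<open>The saddle inequality bounds \<open>?Lt p\<close> by \<open>?Lt ps q\<close>
      for all samples at once, hence also their supremum \<open>?La p\<close>.\<close>
    also have "\<dots> \<le> ereal (?Lt ps q)"
      by (intro L_aug_le_if_Ltilde_aug_le nonneg pC le psC)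
    also have "\<dots> \<le> ?La ps (\<nu>, \<eta>)"
      unfolding q by (intro Ltilde_aug_le_L_aug nonneg psC)
    also have "\<dots> = ?F ps"
      by (simp add: L_aug_feasible[OF psF])
    finally show ?thesis
      using feas min unfolding D_optimizer_def is_arg_min_linorder by (blast intro: order_trans)
  qed
  ultimately show ?thesis
    using optimizer by blast
qed

end
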